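(* For any integer $m\ge 2$ and for any strict ranking pattern $\boldsymbol{\sigma}$ over $[m]$ (i.e. $\boldsymbol{\sigma}\in\hat{\Sigma}^{(m)}$), there exists a voting situation $\mathcal{N}^{(m)}$ which is $q$-concordant with $\boldsymbol{\sigma}$.
   Context: Let $[k]=\{1,\dots,k\}$ (with $[0]=\emptyset$), $[m]$ the set of candidates, and $\Pi_m$ the set of permutations $(j_1,\ldots,j_m)$ of the elements of $[m]$. Ranking functions and patterns. For $A\subseteq[m]$, a map $\sigma(A,\cdot):A\to\{1,\ldots,|A|\}$ is a ranking function if for each $i\in A$, $\sigma(A,i)=1+\left|\{j\in A:\sigma(A,j)\le\sigma(A,i)-1\}\right|$. It is strict if it is injective (hence a bijection onto $\{1,\ldots,|A|\}$), and weak otherwise. A ranking pattern over $[m]$ ($m\ge2$) is a family $\boldsymbol{\sigma}=\{\sigma(A,\cdot):A\subseteq[m],\,|A|\ge2\}$ of ranking functions; it is strict if it contains no weak ranking function. $\Sigma^{(m)}$ and $\hat\Sigma^{(m)}\subset\Sigma^{(m)}$ denote the sets of all ranking patterns and of all strict ranking patterns over $[m]$. Voting situations. A voting situation is a family $\mathcal{N}^{(m)}=\{N^{(m)}(j_1,\ldots,j_m):(j_1,\ldots,j_m)\in\Pi_m\}$ of non-negative integers, where $N^{(m)}(j_1,\ldots,j_m)$ is the number of voters (in a finite nonempty set of voters) whose preference ranking, from most to least preferred, is $(j_1,\ldots,j_m)$. For $A\subseteq[m]$ and $i\in A$, $n_i(A)$ is the number of votes obtained by $i$ when $A$ is the set of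 competing candidates, i.e. the sum of $N^{(m)}(j_1,\ldots,j_m)$ over all $(j_1,\ldots,j_m)\in\Pi_m$ in which $i$ occupies an earlier position than every other element of $A$. Concordance. $\boldsymbol{\sigma}$ and $\mathcal{N}^{(m)}$ are $q$-concordant if for any $A\subseteq[m]$ and $i,j\in A$ with $i\ne j$: $\sigma(A,i)<\sigma(A,j)\Leftrightarrow n_i(A)>n_j(A)$, and $\sigma(A,i)=\sigma(A,j)\Leftrightarrow n_i(A)=n_j(A)$. *)

theory Defs
  imports Complex_Main "HOL-Combinatorics.Multiset_Permutations"
begin

text \<open>
  Candidates are the natural numbers in \<open>{1..m}\<close>. A family of maps \<open>\<sigma>(A, \<sqdot>) : A \<rightarrow> {1..|A|}\<close> is
  a total function \<open>\<sigma> :: nat set \<Rightarrow> nat \<Rightarrow> nat\<close>; only the values \<open>\<sigma> A i\<close> with \<open>A \<subseteq> {1..m}\<close>,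
  \<open>|A| \<ge> 2\<close> and \<open>i \<in> A\<close> matter.
\<close>

definition ranking_function :: "nat set \<Rightarrow> (nat \<Rightarrow> nat) \<Rightarrow> bool" where
  "ranking_function A r \<longleftrightarrow>
     (\<forall>i\<in>A. r i \<in> {1..card A}) \<and>
     (\<forall>i\<in>A. r i = 1 + card {j \<in> A. r j \<le> r i - 1})"

definition strict_ranking_function :: "nat set \<Rightarrow> (nat \<Rightarrow> nat) \<Rightarrow> bool" where
  "strict_ranking_function A r \<longleftrightarrow> ranking_function A r \<and> inj_on r A"

definition weak_ranking_function :: "nat set \<Rightarrow> (nat \<Rightarrow> nat) \<Rightarrow> bool" where
  "weak_ranking_function A r \<longleftrightarrow> ranking_function A r \<and> \<not> strict_ranking_function A r"

definition ranking_pattern :: "nat \<Rightarrow> (nat set \<Rightarrow> nat \<Rightarrow> nat) \<Rightarrow> bool" where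
  "ranking_pattern m \<sigma> \<longleftrightarrow>
     (\<forall>A. A \<subseteq> {1..m} \<and> card A \<ge> 2 \<longrightarrow> ranking_function A (\<sigma> A))"

definition strict_ranking_pattern :: "nat \<Rightarrow> (nat set \<Rightarrow> nat \<Rightarrow> nat) \<Rightarrow> bool" where
  "strict_ranking_pattern m \<sigma> \<longleftrightarrow>
     ranking_pattern m \<sigma> \<and>
     (\<forall>A. A \<subseteq> {1..m} \<and> card A \<ge> 2 \<longrightarrow> \<not> weak_ranking_function A (\<sigma> A))"

text \<open>
  A preference ranking \<open>(j\<^sub>1, \<dots>, j\<^sub>m)\<close> is a list in \<open>permutations_of_set {1..m}\<close>, most preferred
  candidate first. A voting situation assigns a number of voters to each such list (values on
  other lists play no role); the set of voters is nonempty.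
\<close>

definition voting_situation :: "nat \<Rightarrow> (nat list \<Rightarrow> nat) \<Rightarrow> bool" where
  "voting_situation m N \<longleftrightarrow> (\<Sum>js\<in>permutations_of_set {1..m}. N js) > 0"

definition precedes :: "'a list \<Rightarrow> 'a \<Rightarrow> 'a \<Rightarrow> bool" where
  "precedes js i j \<longleftrightarrow> (\<exists>k l. k < l \<and> l < length js \<and> js ! k = i \<and> js ! l = j)"

definition votes :: "nat \<Rightarrow> (nat list \<Rightarrow> nat) \<Rightarrow> nat set \<Rightarrow> nat \<Rightarrow> nat" where
  "votes m N A i =
     (\<Sum>js\<in>{js \<in> permutations_of_set {1..m}. \<forall>j\<in>A - {i}. precedes js i j}. N js)"

definition q_concordant :: "nat \<Rightarrow> (nat set \<Rightarrow> nat \<Rightarrow> nat) \<Rightarrow> (nat list \<Rightarrow> nat) \<Rightarrow> bool" where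
  "q_concordant m \<sigma> N \<longleftrightarrow>
     (\<forall>A i j. A \<subseteq> {1..m} \<and> i \<in> A \<and> j \<in> A \<and> i \<noteq> j \<longrightarrow>
        (\<sigma> A i < \<sigma> A j \<longleftrightarrow> votes m N A i > votes m N A j) \<and>
        (\<sigma> A i = \<sigma> A j \<longleftrightarrow> votes m N A i = votes m N A j))"

end

theory Submission
  imports Defs
begin

text \<open>
  Allow integer (possibly negative) weights first. For \<open>A \<subseteq> X\<close> and \<open>a \<in> A\<close>, let \<open>L a\<close> rank the
  candidates outside \<open>A\<close> first, in a fixed order, then \<open>a\<close>, then the rest of \<open>A\<close>. Putting weights
  \<open>h a\<close> with sum zero on the lists \<open>L a\<close> changes the votes in \<open>A\<close> by exactly \<open>h\<close>, and changes nothing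
  in any \<open>C\<close> not contained in \<open>A\<close>, because the winner of \<open>C\<close> in \<open>L a\<close> then does not depend on \<open>a\<close>.
  Hence arbitrary zero-sum vote counts can be prescribed on all sets, going from large to small
  sets. Finally, adding a large constant to all weights makes them positive and, by symmetry,
  shifts all vote counts within a given set equally.
\<close>

text \<open>Assigns each list a single winner within \<open>A\<close>, so that vote counting becomes
  a partition of the lists. If no entry of the list lies in \<open>A\<close>, the value is the
  unspecified \<open>hd []\<close>.\<close>

definition top_choice :: "'a set \<Rightarrow> 'a list \<Rightarrow> 'a" where
  "top_choice A js = hd (filter (\<lambda>x. x \<in> A) js)"

text \<open>Linear in the weights \<open>N\<close>; integer values allow corrections of either sign
  to be superposed.\<close>

definition weighted_votes :: "'a set \<Rightarrow> ('a list \<Rightarrow> int) \<Rightarrow> 'a set \<Rightarrow> 'a \<Rightarrow> int" where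
  "weighted_votes X N A i =
     (\<Sum>js\<in>permutations_of_set X. if top_choice A js = i then N js else 0)"

lemma precedes_Cons:
  "precedes (x # xs) i j \<longleftrightarrow> (x = i \<and> j \<in> set xs) \<or> precedes xs i j"
proof
  assume "precedes (x # xs) i j"
  then obtain k l where kl: "k < l" "l < length (x # xs)" "(x # xs) ! k = i" "(x # xs) ! l = j"
    unfolding precedes_def by blast
  then obtain l' where l: "l = Suc l'" by (cases l) auto
  show "(x = i \<and> j \<in> set xs) \<or> precedes xs i j"
  proof (cases k)
    case 0
    then show ?thesis using kl l by auto
  next
    case (Suc k')
    then have "k' < l'" "l' < length xs" "xs ! k' = i" "xs ! l' = j" using kl l by auto
    then show ?thesis unfolding precedes_def by blast
  qed
next
  assume "(x = i \<and> j \<in> set xs) \<or> precedes xs i j"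
  then show "precedes (x # xs) i j"
  proof (elim disjE conjE)
    assume "x = i" "j \<in> set xs"
    then obtain l where "l < length xs" "xs ! l = j" by (auto simp: in_set_conv_nth)
    with \<open>x = i\<close> show ?thesis unfolding precedes_def
      by (intro exI[of _ 0] exI[of _ "Suc l"]) auto
  next
    assume "precedes xs i j"
    then obtain k l where "k < l" "l < length xs" "xs ! k = i" "xs ! l = j"
      unfolding precedes_def by blast
    then show ?thesis unfolding precedes_def
      by (intro exI[of _ "Suc k"] exI[of _ "Suc l"]) auto
  qed
qed

lemma precedes_in_set: "precedes xs i j \<Longrightarrow> i \<in> set xs \<and> j \<in> set xs"
  unfolding precedes_def by (meson less_trans nth_mem)

text \<open>Induction on the list: a head outside \<open>A\<close> affects neither side, while a
  head in \<open>A\<close> precedes the rest of \<open>A\<close> and, by distinctness, is preceded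
  by nothing.\<close>

lemma precedes_all_iff_top_choice:
  assumes "distinct js" "A \<subseteq> set js" "i \<in> A"
  shows "(\<forall>j\<in>A - {i}. precedes js i j) \<longleftrightarrow> top_choice A js = i"
  using assms
proof (induction js)
  case Nil
  then show ?case by auto
next
  case (Cons x xs)
  show ?case
  proof (cases "x \<in> A")
    case True
    have "\<not> precedes (x # xs) i x" if "x \<noteq> i"
      using that Cons.prems precedes_in_set[of xs i x] by (auto simp: precedes_Cons)
    with True Cons.prems show ?thesis
      by (cases "x = i") (auto simp: top_choice_def precedes_Cons)
  next
    case False
    then have "A \<subseteq> set xs" "x \<noteq> i" using Cons.prems by auto
    with False Cons show ?thesis by (auto simp: top_choice_def precedes_Cons)
  qed
qed

lemma top_choice_in:
  assumes "A \<subseteq> set js" "A \<noteq> {}"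
  shows "top_choice A js \<in> A"
proof -
  have "filter (\<lambda>x. x \<in> A) js \<noteq> []" using assms by (auto simp: filter_empty_conv)
  then have "hd (filter (\<lambda>x. x \<in> A) js) \<in> set (filter (\<lambda>x. x \<in> A) js)" by (rule hd_in_set)
  then show ?thesis by (simp add: top_choice_def)
qed

text \<open>Every list has exactly one top choice in \<open>A\<close>, so each weight is counted
  once. Hence total weight zero forces zero-sum votes on every nonempty set.\<close>

lemma sum_weighted_votes:
  assumes "finite X" "A \<subseteq> X" "A \<noteq> {}"
  shows "(\<Sum>i\<in>A. weighted_votes X N A i) = sum N (permutations_of_set X)"
proof -
  have fA: "finite A" using assms finite_subset by blast
  have "(\<Sum>i\<in>A. weighted_votes X N A i) =
        (\<Sum>js\<in>permutations_of_set X. \<Sum>i\<in>A. if top_choice A js = i then N js else 0)"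
    unfolding weighted_votes_def by (rule sum.swap)
  also have "\<dots> = sum N (permutations_of_set X)"
    using assms fA by (intro sum.cong) (auto simp: permutations_of_set_def top_choice_in)
  finally show ?thesis .
qed

lemma weighted_votes_add:
  "weighted_votes X (\<lambda>js. N js + M js) A i = weighted_votes X N A i + weighted_votes X M A i"
  unfolding weighted_votes_def sum.distrib[symmetric] by (intro sum.cong) auto

lemma weighted_votes_sum:
  "weighted_votes X (\<lambda>js. \<Sum>k\<in>K. D k js) A i = (\<Sum>k\<in>K. weighted_votes X (D k) A i)"
proof -
  have "weighted_votes X (\<lambda>js. \<Sum>k\<in>K. D k js) A i =
        (\<Sum>js\<in>permutations_of_set X. \<Sum>k\<in>K. if top_choice A js = i then D k js else 0)"
    unfolding weighted_votes_def by (intro sum.cong) auto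
  then show ?thesis unfolding weighted_votes_def by (subst sum.swap)
qed

text \<open>Swapping the names \<open>i\<close> and \<open>j\<close> permutes the lists, maps
  \<open>A\<close> to itself, and exchanges the lists won by \<open>i\<close> with those won by
  \<open>j\<close>.\<close>

lemma weighted_votes_const_eq:
  assumes "A \<subseteq> X" "i \<in> A" "j \<in> A"
  shows "weighted_votes X (\<lambda>_. c) A i = weighted_votes X (\<lambda>_. c) A j"
proof (cases "finite X")
  case True
  let ?t = "transpose i j"
  have inj: "inj ?t" by simp
  have tA: "?t x \<in> A \<longleftrightarrow> x \<in> A" for x using assms by (auto simp: transpose_def)
  have "i \<in> X" "j \<in> X" using assms by blast+
  then have tX: "?t ` X = X" by simp
  have map_perm: "map ?t js \<in> permutations_of_set X" if "js \<in> permutations_of_set X" for js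
    using that inj_on_subset[OF inj subset_UNIV]
    by (simp add: permutations_of_set_def distinct_map tX del: transpose_image_eq)
  have top: "top_choice A (map ?t js) = ?t (top_choice A js)"
    if "js \<in> permutations_of_set X" for js
  proof -
    have "filter (\<lambda>x. x \<in> A) js \<noteq> []"
      using that assms by (auto simp: permutations_of_set_def filter_empty_conv)
    then show ?thesis by (simp add: top_choice_def filter_map comp_def tA hd_map)
  qed
  have tt: "?t x = j \<longleftrightarrow> x = i" for x by (auto simp: transpose_def)
  have bij: "bij_betw (map ?t) (permutations_of_set X) (permutations_of_set X)"
    by (rule bij_betwI[where g = "map ?t"]) (simp_all add: map_perm)
  have "weighted_votes X (\<lambda>_. c) A j =
        (\<Sum>js\<in>permutations_of_set X. if top_choice A (map ?t js) = j then c else 0)"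
    unfolding weighted_votes_def by (rule sum.reindex_bij_betw[OF bij, symmetric])
  also have "\<dots> = weighted_votes X (\<lambda>_. c) A i"
    unfolding weighted_votes_def by (intro sum.cong) (auto simp: top tt)
  finally show ?thesis by simp
next
  case False
  then show ?thesis by (simp add: weighted_votes_def permutations_of_set_infinite)
qed

text \<open>The first conjunct keeps the total weight at zero, so that further adjustments can
  follow on smaller sets.\<close>

lemma exists_local_adjustment:
  fixes h :: "'a \<Rightarrow> int"
  assumes X: "finite X" and A: "A \<subseteq> X" and h: "sum h A = 0"
  shows "\<exists>D. sum D (permutations_of_set X) = 0 \<and>
             (\<forall>i\<in>A. weighted_votes X D A i = h i) \<and>
             (\<forall>C\<subseteq>X. \<not> C \<subseteq> A \<longrightarrow> (\<forall>i. weighted_votes X D C i = 0))"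
proof -
  have fA: "finite A" using A X finite_subset by blast
  obtain bs where bs: "set bs = X - A" "distinct bs"
    using finite_distinct_list[of "X - A"] X by blast
  have "\<exists>as. set as = A - {a} \<and> distinct as" for a
    using finite_distinct_list[of "A - {a}"] fA by simp
  then obtain r where r: "\<And>a. set (r a) = A - {a}" "\<And>a. distinct (r a)" by metis
  define L where "L a = bs @ a # r a" for a
  \<comment> \<open>Writing the weight as a sum over \<open>A\<close> lets linearity apply directly,
    without an injectivity argument for \<open>L\<close>.\<close>
  define D where "D js = (\<Sum>a\<in>A. if js = L a then h a else 0)" for js
  have L: "L a \<in> permutations_of_set X" if "a \<in> A" for a
    using that A bs r by (auto simp: L_def permutations_of_set_def)
  have total: "sum D (permutations_of_set X) = 0"
  proof -
    have "sum D (permutations_of_set X) =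
          (\<Sum>a\<in>A. \<Sum>js\<in>permutations_of_set X. if js = L a then h a else 0)"
      unfolding D_def by (rule sum.swap)
    also have "\<dots> = sum h A" by (intro sum.cong) (auto simp: L)
    finally show ?thesis using h by simp
  qed
  have votes: "weighted_votes X D C i = (\<Sum>a\<in>A. if top_choice C (L a) = i then h a else 0)" for C i
  proof -
    have "weighted_votes X D C i = (\<Sum>a\<in>A. \<Sum>js\<in>permutations_of_set X.
            if js = L a then (if top_choice C (L a) = i then h a else 0) else 0)"
      unfolding D_def weighted_votes_sum unfolding weighted_votes_def
      by (intro sum.cong) auto
    also have "\<dots> = (\<Sum>a\<in>A. if top_choice C (L a) = i then h a else 0)"
      by (intro sum.cong refl) (auto simp: L)
    finally show ?thesis .
  qed
  have "filter (\<lambda>x. x \<in> A) bs = []" using bs by (auto simp: filter_empty_conv)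
  then have "top_choice A (L a) = a" if "a \<in> A" for a
    using that by (simp add: top_choice_def L_def)
  then have "weighted_votes X D A i = h i" if "i \<in> A" for i
    unfolding votes using that fA by (simp cong: sum.cong)
  moreover have "weighted_votes X D C i = 0" if "C \<subseteq> X" "\<not> C \<subseteq> A" for C i
  proof -
    \<comment> \<open>\<open>C\<close> has an element outside \<open>A\<close>, so its winner
      already occurs in the common prefix \<open>bs\<close>. One candidate then receives all of
      \<open>sum h A = 0\<close>.\<close>
    have "filter (\<lambda>x. x \<in> C) bs \<noteq> []" using that bs by (auto simp: filter_empty_conv)
    then have "top_choice C (L a) = top_choice C bs" for a
      by (simp add: top_choice_def L_def)
    then show ?thesis unfolding votes using h by (cases "top_choice C bs = i") simp_all
  qed
  ultimately show ?thesis using total by blast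
qed

text \<open>Induction on the number \<open>d\<close> of size layers already settled, from
  \<open>X\<close> downwards; \<open>d = 0\<close> is vacuous. Total weight zero is carried along as
  an invariant: it makes the remaining error on each set sum to zero.\<close>

lemma exists_prescribed_votes_large_sets:
  fixes g :: "'a set \<Rightarrow> 'a \<Rightarrow> int"
  assumes X: "finite X" and g: "\<And>A. A \<subseteq> X \<Longrightarrow> sum (g A) A = 0"
  shows "\<exists>N. sum N (permutations_of_set X) = 0 \<and>
             (\<forall>A\<subseteq>X. card X < card A + d \<longrightarrow> (\<forall>i\<in>A. weighted_votes X N A i = g A i))"
proof (induction d)
  case 0
  have "\<not> card X < card A" if "A \<subseteq> X" for A
    using card_mono[OF X that] by simp
  then show ?case by (intro exI[of _ "\<lambda>_. 0"]) simp
next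
  case (Suc d)
  then obtain N where N0: "sum N (permutations_of_set X) = 0"
    and N: "\<And>A i. A \<subseteq> X \<Longrightarrow> card X < card A + d \<Longrightarrow> i \<in> A \<Longrightarrow> weighted_votes X N A i = g A i"
    by blast
  \<comment> \<open>The next layer: all sets of size \<open>card X - d\<close>, each given its own
    adjustment.\<close>
  define F where "F = {A. A \<subseteq> X \<and> card A + d = card X}"
  have fF: "finite F" using X unfolding F_def by simp
  have "\<exists>D. sum D (permutations_of_set X) = 0 \<and>
             (\<forall>i\<in>A. weighted_votes X D A i = g A i - weighted_votes X N A i) \<and>
             (\<forall>C\<subseteq>X. \<not> C \<subseteq> A \<longrightarrow> (\<forall>i. weighted_votes X D C i = 0))" if "A \<in> F" for A
  proof (rule exists_local_adjustment[OF X])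
    show AX: "A \<subseteq> X" using that by (simp add: F_def)
    have "(\<Sum>i\<in>A. weighted_votes X N A i) = 0"
      by (cases "A = {}") (simp_all add: sum_weighted_votes[OF X AX] N0)
    then show "(\<Sum>i\<in>A. g A i - weighted_votes X N A i) = 0"
      using g[OF AX] by (simp add: sum_subtractf)
  qed
  then obtain D where D0: "\<And>A. A \<in> F \<Longrightarrow> sum (D A) (permutations_of_set X) = 0"
    and DA: "\<And>A i. A \<in> F \<Longrightarrow> i \<in> A \<Longrightarrow>
               weighted_votes X (D A) A i = g A i - weighted_votes X N A i"
    and DC: "\<And>A C i. A \<in> F \<Longrightarrow> C \<subseteq> X \<Longrightarrow> \<not> C \<subseteq> A \<Longrightarrow> weighted_votes X (D A) C i = 0"
    by metis
  define M where "M js = N js + (\<Sum>A\<in>F. D A js)" for js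
  have "sum M (permutations_of_set X) = (\<Sum>A\<in>F. sum (D A) (permutations_of_set X))"
    unfolding M_def sum.distrib N0 by (simp add: sum.swap[of _ F])
  then have M0: "sum M (permutations_of_set X) = 0" by (simp add: D0)
  have "weighted_votes X M C i = g C i"
    if C: "C \<subseteq> X" "card X < card C + Suc d" "i \<in> C" for C i
  proof -
    \<comment> \<open>\<open>C\<close> is at least as large as \<open>A\<close>, so it could lie
      inside \<open>A\<close> only by being equal to it. Adjustments within a layer therefore do not
      interfere, and settled larger sets stay settled.\<close>
    have zero: "weighted_votes X (D A) C i = 0" if "A \<in> F" "A \<noteq> C" for A
    proof (rule DC[OF \<open>A \<in> F\<close> C(1)])
      have "finite A" "card A \<le> card C"
        using \<open>A \<in> F\<close> C(2) X finite_subset by (auto simp: F_def)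
      then show "\<not> C \<subseteq> A" using \<open>A \<noteq> C\<close> card_seteq by blast
    qed
    have eq: "weighted_votes X M C i =
              weighted_votes X N C i + (\<Sum>A\<in>F. weighted_votes X (D A) C i)"
      unfolding M_def weighted_votes_add weighted_votes_sum ..
    show ?thesis
    proof (cases "C \<in> F")
      case True
      have "(\<Sum>A\<in>F. weighted_votes X (D A) C i) = weighted_votes X (D C) C i"
        using True fF zero by (subst sum.remove[of _ C]) auto
      then show ?thesis using eq DA[OF True C(3)] by simp
    next
      case False
      then have "(\<Sum>A\<in>F. weighted_votes X (D A) C i) = 0"
        by (intro sum.neutral ballI zero) auto
      moreover have "card X < card C + d" using False C by (auto simp: F_def)
      ultimately show ?thesis using eq N C by simp
    qed
  qed
  with M0 show ?case by blast
qed

lemma exists_prescribed_votes: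
  fixes g :: "'a set \<Rightarrow> 'a \<Rightarrow> int"
  assumes "finite X" and "\<And>A. A \<subseteq> X \<Longrightarrow> sum (g A) A = 0"
  shows "\<exists>N. \<forall>A\<subseteq>X. \<forall>i\<in>A. weighted_votes X N A i = g A i"
proof -
  \<comment> \<open>At \<open>d = Suc (card X)\<close> the size condition holds for every
    subset.\<close>
  obtain N where "\<forall>A\<subseteq>X. card X < card A + Suc (card X) \<longrightarrow>
                    (\<forall>i\<in>A. weighted_votes X N A i = g A i)"
    using exists_prescribed_votes_large_sets[OF assms] by blast
  then show ?thesis by auto
qed

lemma votes_eq_weighted_votes:
  assumes "A \<subseteq> {1..m}" "i \<in> A"
  shows "int (votes m N A i) = weighted_votes {1..m} (\<lambda>js. int (N js)) A i"
proof -
  have "{js \<in> permutations_of_set {1..m}. \<forall>j\<in>A - {i}. precedes js i j} =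
        {js \<in> permutations_of_set {1..m}. top_choice A js = i}"
    using assms by (intro Collect_cong conj_cong refl precedes_all_iff_top_choice)
      (auto simp: permutations_of_set_def)
  then show ?thesis
    unfolding votes_def weighted_votes_def by (auto simp: sum.inter_filter intro: sum.cong)
qed

theorem theorem1:
  fixes m :: nat and \<sigma> :: "nat set \<Rightarrow> nat \<Rightarrow> nat"
  assumes "m \<ge> 2"
    and "strict_ranking_pattern m \<sigma>"
  shows "\<exists>N :: nat list \<Rightarrow> nat. voting_situation m N \<and> q_concordant m \<sigma> N"
proof -
  let ?X = "{1..m}"
  let ?P = "permutations_of_set ?X"
  \<comment> \<open>This is \<open>card A\<close> times the mean rank minus the rank of
    \<open>i\<close>: zero-sum over \<open>A\<close>, and larger for better ranked
    candidates.\<close>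
  define g where "g A i = (\<Sum>j\<in>A. int (\<sigma> A j)) - int (card A) * int (\<sigma> A i)" for A i
  have "sum (g A) A = 0" for A
    by (simp add: g_def sum_subtractf sum_distrib_left)
  then obtain W where W: "\<And>A i. A \<subseteq> ?X \<Longrightarrow> i \<in> A \<Longrightarrow> weighted_votes ?X W A i = g A i"
    using exists_prescribed_votes[of ?X g] by blast
  \<comment> \<open>Exceeds every \<bar>\<open>W js\<close>\<bar>, so all shifted weights are
    strictly positive; \<open>nat\<close> then loses nothing on the lists that count, and there is
    at least one voter.\<close>
  define K where "K = 1 + (\<Sum>js\<in>?P. \<bar>W js\<bar>)"
  have pos: "W js + K > 0" if "js \<in> ?P" for js
    using member_le_sum[of js ?P "\<lambda>js. \<bar>W js\<bar>"] that by (simp add: K_def)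
  define N where "N js = nat (W js + K)" for js
  have votes_N: "int (votes m N A i) = g A i + weighted_votes ?X (\<lambda>_. K) A i"
    if "A \<subseteq> ?X" "i \<in> A" for A i
  proof -
    have "int (votes m N A i) = weighted_votes ?X (\<lambda>js. int (N js)) A i"
      using that by (rule votes_eq_weighted_votes)
    also have "\<dots> = weighted_votes ?X (\<lambda>js. W js + K) A i"
      unfolding weighted_votes_def using pos by (intro sum.cong) (auto simp: N_def less_imp_le)
    finally show ?thesis using W[OF that] by (simp add: weighted_votes_add)
  qed
  have "voting_situation m N"
    unfolding voting_situation_def using pos by (intro sum_pos) (auto simp: N_def)
  moreover have "q_concordant m \<sigma> N"
    unfolding q_concordant_def
  proof (intro allI impI)
    fix A i j
    assume *: "A \<subseteq> ?X \<and> i \<in> A \<and> j \<in> A \<and> i \<noteq> j"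
    then have "card A > 0" by (auto simp: card_gt_0_iff intro: finite_subset)
    \<comment> \<open>The contribution of \<open>K\<close> and the rank sum in \<open>g\<close> are
      the same for \<open>i\<close> and \<open>j\<close> and cancel.\<close>
    have "int (votes m N A i) - int (votes m N A j) =
                   int (card A) * int (\<sigma> A j) - int (card A) * int (\<sigma> A i)"
      using * votes_N[of A i] votes_N[of A j] weighted_votes_const_eq[of A ?X i j K]
      by (simp add: g_def)
    \<comment> \<open>Stated additively to avoid truncated subtraction on naturals: more votes must
      offset a smaller rank.\<close>
    then have "votes m N A i + card A * \<sigma> A i = votes m N A j + card A * \<sigma> A j"
      unfolding of_nat_mult[symmetric] by linarith
    moreover have "card A * \<sigma> A k < card A * \<sigma> A l \<longleftrightarrow> \<sigma> A k < \<sigma> A l" for k l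
      using \<open>card A > 0\<close> by simp
    ultimately show "(\<sigma> A i < \<sigma> A j \<longleftrightarrow> votes m N A i > votes m N A j) \<and>
                     (\<sigma> A i = \<sigma> A j \<longleftrightarrow> votes m N A i = votes m N A j)"
      by (smt (verit) add_less_cancel_left nat_neq_iff less_add_eq_less add.commute)
  qed
  ultimately show ?thesis by blast
qed

end
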